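(* Let $\Psi$ be a gradient quadratic differential on a compact Riemann surface $Y$ without boundary, and let $F$ be any potential of $\Psi$. Then the Levy form $\mu_F$ is supported on $K_\Psi\cup Cr_\Psi$.
   Context: $Y$ is a compact connected Riemann surface without boundary; $\Psi$ is a meromorphic quadratic differential on $Y$, not identically zero, written locally as $f(z)\,dz^2$. The set $Cr_\Psi$ of critical points is the set of zeros and poles of $\Psi$. Zeros and simple poles are finite critical points; poles of order at least $2$ are infinite critical points. Horizontal trajectories (or simply trajectories) are the (maximal) integral curves in $Y\setminus Cr_\Psi$ of the line field spanned by tangent vectors $\xi$ with $f(z)\xi^2>0$. A trajectory is critical if its closure contains a finite critical point. $K_\Psi\subset Y$ is the closure of the union of the critical trajectories. A level function of $\Psi$ is a continuous and piecewise smooth function $F:Y\setminus Cr_\Psi\to\mathbb R$ which is non-constant on every non-empty open subset of $Y\setminus Cr_\Psi$ and constant on each horizontal trajectory; $\Psi$ is non-chaotic if it has a level function. A level function $F$ is natural if on each connected component of $Y\setminus (K_\Psi\cup Cr_\Psi)$ one has $dF=\pm\operatorname{Im}\sqrt\Psi$, with one choice of branch of $\sqrt\Psi$ and sign on the whole component. A non-chaotic $\Psi$ admitting a natural level function is called gradient, and any natural level function of it is called a potential of $\Psi$. The Levy form of a function (or distribution) $h$ is the 2-current $\mu_h=2i\,\frac{\partial^2h}{\partial z\,\partial\bar z}\,dz\wedge d\bar z$, equal to $\Delta h\,dx\wedge dy$ in a local coordinate $z=x+iy$. That $\mu_F$ is supported on a closed set $S\supset Cr_\Psi$ means that $\mu_F$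 vanishes as a current on $Y\setminus S$. *)

theory Defs
  imports "HOL-Complex_Analysis.Complex_Analysis"
begin

section \<open>Riemann surfaces\<close>

text \<open>
  The surface is a whole type \<open>'a\<close>; its complex structure is given by a holomorphic atlas, a set
  of charts \<open>(U, \<phi>)\<close>. The values of \<open>\<phi>\<close> outside \<open>U\<close> are irrelevant. The atlas is not assumed to
  be maximal, but it may be.
\<close>

type_synonym 'a chart = "'a set \<times> ('a \<Rightarrow> complex)"

abbreviation chart_inv :: "'a chart \<Rightarrow> complex \<Rightarrow> 'a"
  where "chart_inv c \<equiv> inv_into (fst c) (snd c)"

definition is_chart :: "'a::topological_space chart \<Rightarrow> bool"
  where "is_chart c \<longleftrightarrow>
    open (fst c) \<and> open (snd c ` fst c) \<and>
    homeomorphism (fst c) (snd c ` fst c) (snd c) (chart_inv c)"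

definition transition :: "'a chart \<Rightarrow> 'a chart \<Rightarrow> complex \<Rightarrow> complex"
  where "transition c d = snd d \<circ> chart_inv c"

definition holomorphic_atlas :: "'a::topological_space chart set \<Rightarrow> bool"
  where "holomorphic_atlas A \<longleftrightarrow>
    (\<forall>c\<in>A. is_chart c) \<and>
    (\<Union>c\<in>A. fst c) = UNIV \<and>
    (\<forall>c\<in>A. \<forall>d\<in>A. transition c d holomorphic_on snd c ` (fst c \<inter> fst d))"

text \<open>Second countability is automatic for a compact surface.\<close>

definition compact_riemann_surface :: "'a::t2_space chart set \<Rightarrow> bool"
  where "compact_riemann_surface A \<longleftrightarrow>
    holomorphic_atlas A \<and> compact (UNIV :: 'a set) \<and> connected (UNIV :: 'a set)"


section \<open>Quadratic differentials\<close>

text \<open>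
  \<open>\<Psi> c\<close> is the coefficient \<open>f\<close> of \<open>f(z) dz\<^sup>2\<close> in the chart \<open>c\<close>. It is required to be
  nicely meromorphic, i.e. to have no removable singularities and to take the library's
  conventional value 0 at its poles, so that the transformation rule can be imposed at every point:
  at a pole both sides are 0.
\<close>

type_synonym 'a qdiff = "'a chart \<Rightarrow> complex \<Rightarrow> complex"

definition meromorphic_qdiff :: "'a::topological_space chart set \<Rightarrow> 'a qdiff \<Rightarrow> bool"
  where "meromorphic_qdiff A \<Psi> \<longleftrightarrow>
    (\<forall>c\<in>A. \<Psi> c nicely_meromorphic_on snd c ` fst c) \<and>
    (\<forall>c\<in>A. \<forall>d\<in>A. \<forall>z\<in>snd c ` (fst c \<inter> fst d).
       \<Psi> c z = \<Psi> d (transition c d z) * (deriv (transition c d) z)\<^sup>2)"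

definition not_identically_zero :: "'a chart set \<Rightarrow> 'a qdiff \<Rightarrow> bool"
  where "not_identically_zero A \<Psi> \<longleftrightarrow> (\<exists>c\<in>A. \<exists>z\<in>snd c ` fst c. \<Psi> c z \<noteq> 0)"

definition qdiff_zeros :: "'a chart set \<Rightarrow> 'a qdiff \<Rightarrow> 'a set"
  where "qdiff_zeros A \<Psi> =
    {p. \<exists>c\<in>A. p \<in> fst c \<and> \<Psi> c (snd c p) = 0 \<and> \<not> is_pole (\<Psi> c) (snd c p)}"

definition qdiff_poles :: "'a chart set \<Rightarrow> 'a qdiff \<Rightarrow> 'a set"
  where "qdiff_poles A \<Psi> = {p. \<exists>c\<in>A. p \<in> fst c \<and> is_pole (\<Psi> c) (snd c p)}"

definition qdiff_simple_poles :: "'a chart set \<Rightarrow> 'a qdiff \<Rightarrow> 'a set"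
  where "qdiff_simple_poles A \<Psi> =
    {p. \<exists>c\<in>A. p \<in> fst c \<and> is_pole (\<Psi> c) (snd c p) \<and> zorder (\<Psi> c) (snd c p) = -1}"

definition critical_points :: "'a chart set \<Rightarrow> 'a qdiff \<Rightarrow> 'a set"
  where "critical_points A \<Psi> = qdiff_zeros A \<Psi> \<union> qdiff_poles A \<Psi>"

definition finite_critical_points :: "'a chart set \<Rightarrow> 'a qdiff \<Rightarrow> 'a set"
  where "finite_critical_points A \<Psi> = qdiff_zeros A \<Psi> \<union> qdiff_simple_poles A \<Psi>"


section \<open>Horizontal trajectories\<close>

definition horizontal_curve ::
    "'a::topological_space chart set \<Rightarrow> 'a qdiff \<Rightarrow> real set \<Rightarrow> (real \<Rightarrow> 'a) \<Rightarrow> bool"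
  where "horizontal_curve A \<Psi> I \<gamma> \<longleftrightarrow>
    I \<noteq> {} \<and> open I \<and> is_interval I \<and>
    continuous_on I \<gamma> \<and> \<gamma> ` I \<subseteq> - critical_points A \<Psi> \<and>
    (\<forall>t\<in>I. \<forall>c\<in>A. \<gamma> t \<in> fst c \<longrightarrow>
       (\<exists>\<xi>. (snd c \<circ> \<gamma> has_vector_derivative \<xi>) (at t) \<and>
            \<Psi> c (snd c (\<gamma> t)) * \<xi>\<^sup>2 \<in> complex_of_real ` {0<..}))"

text \<open>
  Trajectories are unparametrized, and maximality refers to the image: extendability of the
  parameter interval would depend on the parametrization.
\<close>

definition horizontal_trajectory ::
    "'a::topological_space chart set \<Rightarrow> 'a qdiff \<Rightarrow> 'a set \<Rightarrow> bool"
  where "horizontal_trajectory A \<Psi> T \<longleftrightarrow>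
    (\<exists>I \<gamma>. horizontal_curve A \<Psi> I \<gamma> \<and> T = \<gamma> ` I) \<and>
    (\<forall>I \<gamma>. horizontal_curve A \<Psi> I \<gamma> \<and> T \<subseteq> \<gamma> ` I \<longrightarrow> \<gamma> ` I = T)"

definition critical_trajectory ::
    "'a::topological_space chart set \<Rightarrow> 'a qdiff \<Rightarrow> 'a set \<Rightarrow> bool"
  where "critical_trajectory A \<Psi> T \<longleftrightarrow>
    horizontal_trajectory A \<Psi> T \<and> closure T \<inter> finite_critical_points A \<Psi> \<noteq> {}"

definition critical_graph :: "'a::topological_space chart set \<Rightarrow> 'a qdiff \<Rightarrow> 'a set"
  where "critical_graph A \<Psi> = closure (\<Union>{T. critical_trajectory A \<Psi> T})"


section \<open>Smooth functions in the plane\<close>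

definition partial_x :: "(complex \<Rightarrow> real) \<Rightarrow> complex \<Rightarrow> real"
  where "partial_x g z = deriv (\<lambda>t::real. g (z + of_real t)) 0"

definition partial_y :: "(complex \<Rightarrow> real) \<Rightarrow> complex \<Rightarrow> real"
  where "partial_y g z = deriv (\<lambda>t::real. g (z + \<i> * of_real t)) 0"

definition laplacian :: "(complex \<Rightarrow> real) \<Rightarrow> complex \<Rightarrow> real"
  where "laplacian g z = partial_x (partial_x g) z + partial_y (partial_y g) z"

text \<open>Used for open sets only.\<close>

primrec Ck_on :: "nat \<Rightarrow> complex set \<Rightarrow> (complex \<Rightarrow> real) \<Rightarrow> bool"
  where
    "Ck_on 0 S g \<longleftrightarrow> continuous_on S g"
  | "Ck_on (Suc k) S g \<longleftrightarrow>
       g differentiable_on S \<and> Ck_on k S (partial_x g) \<and> Ck_on k S (partial_y g)"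

definition smooth_on :: "complex set \<Rightarrow> (complex \<Rightarrow> real) \<Rightarrow> bool"
  where "smooth_on S g \<longleftrightarrow> (\<forall>k. Ck_on k S g)"


section \<open>Level functions and potentials\<close>

text \<open>
  Functions on \<open>Y \<setminus> Cr\<close> are total functions whose values on \<open>Cr\<close> are ignored. Piecewise smoothness
  on an open set \<open>W\<close>: locally, finitely many closed pieces, on each of which the function is the
  restriction of a smooth function. By Baire's theorem the pieces may be replaced by the closures of
  their interiors, so lower-dimensional pieces add no generality.
\<close>

definition piecewise_smooth_on ::
    "'a::topological_space chart set \<Rightarrow> 'a set \<Rightarrow> ('a \<Rightarrow> real) \<Rightarrow> bool"
  where "piecewise_smooth_on A W F \<longleftrightarrow>
    (\<forall>p\<in>W. \<exists>c\<in>A. p \<in> fst c \<and>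
      (\<exists>V P. open V \<and> snd c p \<in> V \<and> V \<subseteq> snd c ` (fst c \<inter> W) \<and>
         finite P \<and> V \<subseteq> \<Union>P \<and>
         (\<forall>D\<in>P. closed D \<and>
            (\<exists>g. smooth_on V g \<and> (\<forall>z\<in>V \<inter> D. F (chart_inv c z) = g z)))))"

definition level_function ::
    "'a::topological_space chart set \<Rightarrow> 'a qdiff \<Rightarrow> ('a \<Rightarrow> real) \<Rightarrow> bool"
  where "level_function A \<Psi> F \<longleftrightarrow>
    continuous_on (- critical_points A \<Psi>) F \<and>
    piecewise_smooth_on A (- critical_points A \<Psi>) F \<and>
    (\<forall>V. open V \<and> V \<noteq> {} \<and> V \<subseteq> - critical_points A \<Psi> \<longrightarrow> \<not> F constant_on V) \<and>
    (\<forall>T. horizontal_trajectory A \<Psi> T \<longrightarrow> F constant_on T)"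

definition non_chaotic :: "'a::topological_space chart set \<Rightarrow> 'a qdiff \<Rightarrow> bool"
  where "non_chaotic A \<Psi> \<longleftrightarrow> (\<exists>F. level_function A \<Psi> F)"

text \<open>
  A branch of the square root of \<open>\<Psi>\<close> on \<open>W\<close> is a holomorphic 1-form on \<open>W\<close>, written
  \<open>\<omega> c (z) dz\<close> in the chart \<open>c\<close>, whose square is \<open>\<Psi>\<close>.
\<close>

definition sqrt_branch ::
    "'a chart set \<Rightarrow> 'a qdiff \<Rightarrow> 'a set \<Rightarrow> ('a chart \<Rightarrow> complex \<Rightarrow> complex) \<Rightarrow> bool"
  where "sqrt_branch A \<Psi> W \<omega> \<longleftrightarrow>
    (\<forall>c\<in>A. \<omega> c holomorphic_on snd c ` (fst c \<inter> W) \<and>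
       (\<forall>z\<in>snd c ` (fst c \<inter> W). (\<omega> c z)\<^sup>2 = \<Psi> c z)) \<and>
    (\<forall>c\<in>A. \<forall>d\<in>A. \<forall>z\<in>snd c ` (fst c \<inter> fst d \<inter> W).
       \<omega> c z = \<omega> d (transition c d z) * deriv (transition c d) z)"

text \<open>The linear form \<open>v \<mapsto> \<epsilon> Im (\<omega> c (z) v)\<close> is \<open>\<epsilon> Im \<omega>\<close> at \<open>z\<close>.\<close>

definition natural_level_function ::
    "'a::topological_space chart set \<Rightarrow> 'a qdiff \<Rightarrow> ('a \<Rightarrow> real) \<Rightarrow> bool"
  where "natural_level_function A \<Psi> F \<longleftrightarrow>
    level_function A \<Psi> F \<and>
    (\<forall>W\<in>components (- (critical_graph A \<Psi> \<union> critical_points A \<Psi>)).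
       \<exists>\<omega>. sqrt_branch A \<Psi> W \<omega> \<and>
         (\<exists>\<epsilon>\<in>{1, -1}. \<forall>c\<in>A. \<forall>z\<in>snd c ` (fst c \<inter> W).
            (F \<circ> chart_inv c has_derivative (\<lambda>v. \<epsilon> * Im (\<omega> c z * v))) (at z)))"

definition gradient_qdiff :: "'a::topological_space chart set \<Rightarrow> 'a qdiff \<Rightarrow> bool"
  where "gradient_qdiff A \<Psi> \<longleftrightarrow>
    non_chaotic A \<Psi> \<and> (\<exists>F. natural_level_function A \<Psi> F)"

definition potential ::
    "'a::topological_space chart set \<Rightarrow> 'a qdiff \<Rightarrow> ('a \<Rightarrow> real) \<Rightarrow> bool"
  where "potential A \<Psi> F \<longleftrightarrow> gradient_qdiff A \<Psi> \<and> natural_level_function A \<Psi> F"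


section \<open>The Levy form as a current\<close>

text \<open>
  As for distributions on manifolds in general, a 2-current is given by its local representatives:
  in each chart \<open>c\<close>, a functional \<open>T c\<close> on test functions supported in the coordinate domain
  (a distribution times \<open>dx \<and> dy\<close>). It vanishes on an open set if all its representatives do.
\<close>

definition test_function_on :: "complex set \<Rightarrow> (complex \<Rightarrow> real) \<Rightarrow> bool"
  where "test_function_on V \<eta> \<longleftrightarrow>
    smooth_on UNIV \<eta> \<and> compact (closure {z. \<eta> z \<noteq> 0}) \<and> closure {z. \<eta> z \<noteq> 0} \<subseteq> V"

type_synonym 'a current2 = "'a chart \<Rightarrow> (complex \<Rightarrow> real) \<Rightarrow> real"

definition current_vanishes_on :: "'a chart set \<Rightarrow> 'a current2 \<Rightarrow> 'a set \<Rightarrow> bool"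
  where "current_vanishes_on A T W \<longleftrightarrow>
    (\<forall>c\<in>A. \<forall>\<eta>. test_function_on (snd c ` (fst c \<inter> W)) \<eta> \<longrightarrow> T c \<eta> = 0)"

definition current_supported_on :: "'a chart set \<Rightarrow> 'a current2 \<Rightarrow> 'a set \<Rightarrow> bool"
  where "current_supported_on A T S \<longleftrightarrow> current_vanishes_on A T (- S)"

text \<open>
  Since \<open>2 i dz \<and> d\<bar>z\<close> is \<open>4 dx \<and> dy\<close> and \<open>\<partial>\<^sup>2/\<partial>z \<partial>\<bar>z\<close> is a quarter of the
  Laplacian, the Levy form of \<open>h\<close> is the distributional Laplacian of \<open>h\<close> times \<open>dx \<and> dy\<close>, and it
  pairs with \<open>\<eta>\<close> to the integral of \<open>h \<Delta>\<eta>\<close>. For \<open>h\<close> continuous outside a closed set and \<open>\<eta>\<close>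
  supported outside that set, the integrand is continuous with compact support, and the values
  of \<open>h\<close> on that set are irrelevant.
\<close>

definition levy_form :: "('a \<Rightarrow> real) \<Rightarrow> 'a current2"
  where "levy_form h c \<eta> =
    (LINT z:snd c ` fst c|lborel. h (chart_inv c z) * laplacian \<eta> z)"

end

theory Submission
  imports Defs
begin

text \<open>
  Off \<open>K\<^sub>\<Psi> \<union> Cr\<^sub>\<Psi>\<close> a potential is locally \<open>\<plusminus> Im \<integral>\<surd>\<Psi>\<close> up to a constant, the imaginary part of a holomorphic
  function, so it is harmonic there, and its distributional Laplacian vanishes by Green's formula.

  In a chart, the definition of a natural level function gives the differential of \<open>F\<close> as \<open>Im (g dz)\<close>
  with \<open>g = \<plusminus>\<surd>\<Psi>\<close>. The branch and the sign depend on the component of the complement of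
  \<open>K\<^sub>\<Psi> \<union> Cr\<^sub>\<Psi>\<close>, but a small coordinate disc lies in a single component, so \<open>g\<close> is holomorphic on the
  whole coordinate image \<open>V\<close> of that complement (\<open>natural_level_function_local_derivative\<close>). The set
  \<open>V\<close> is open because critical points form a closed set: by the transformation rule they are the
  points at which the coefficient of \<open>\<Psi>\<close> takes the value 0 in any given chart, and \<open>\<Psi>\<close> is continuous
  where this value is not 0 (\<open>closed_critical_points\<close>).

  It remains to show \<open>\<integral> h \<Delta>\<eta> = 0\<close> for \<open>h\<close> with \<open>dh = Im (g dz)\<close> and \<open>\<eta>\<close> with compact support in \<open>V\<close>.
  For a constant direction \<open>v\<close>, the function \<open>h \<partial>\<^sub>v\<eta> - \<eta> \<partial>\<^sub>vh\<close>, extended by 0 outside \<open>V\<close>, is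
  continuously differentiable along \<open>v\<close> with compact support. Its \<open>v\<close>-derivative
  \<open>h \<partial>\<^sub>v\<partial>\<^sub>v\<eta> - \<eta> Im (g' v\<^sup>2)\<close> has integral 0
  (\<open>has_bochner_integral_Green_direction\<close>). On adding the cases \<open>v = 1\<close> and \<open>v = \<i>\<close> the terms with \<open>g'\<close>
  cancel, as \<open>1\<^sup>2 + \<i>\<^sup>2 = 0\<close>, and \<open>h \<Delta>\<eta>\<close> is left.
\<close>


section \<open>Integrals of derivatives of compactly supported functions\<close>

lemma continuous_on_extend_zero:
  fixes f :: "'a::t2_space \<Rightarrow> real"
  assumes "open V" "compact K" "K \<subseteq> V" "continuous_on V f" "\<And>z. z \<in> V - K \<Longrightarrow> f z = 0"
  shows "continuous_on UNIV (\<lambda>z. if z \<in> V then f z else 0)"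
proof -
  let ?u = "\<lambda>z. if z \<in> V then f z else 0"
  have "open (- K)" using assms(2) by (simp add: compact_imp_closed open_Compl)
  moreover have "continuous_on V ?u"
    using assms(4) by (rule continuous_on_eq) simp
  moreover have "continuous_on (- K) ?u"
    by (rule continuous_on_eq[OF continuous_on_const[of _ 0]]) (use assms(5) in auto)
  ultimately have "continuous_on (V \<union> - K) ?u"
    using assms(1) by (intro continuous_on_open_Un)
  moreover have "V \<union> - K = UNIV" using assms(3) by auto
  ultimately show ?thesis by simp
qed

text \<open>
  By translation invariance of Lebesgue measure, every difference quotient of \<open>f\<close> in direction \<open>v\<close>
  has integral 0, and the quotients converge to the derivative. By the mean value theorem they are
  bounded by a bound of \<open>f'\<close>, and for steps of length at most 1 they vanish outside a
  common ball, so dominated convergence applies.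
\<close>

lemma has_bochner_integral_directional_derivative_0:
  fixes f f' :: "'a::euclidean_space \<Rightarrow> real"
  assumes K: "compact K" and f: "continuous_on UNIV f" and f': "continuous_on UNIV f'"
    and f0: "\<And>z. z \<notin> K \<Longrightarrow> f z = 0" and f'0: "\<And>z. z \<notin> K \<Longrightarrow> f' z = 0"
    and der: "\<And>z. ((\<lambda>t. f (z + t *\<^sub>R v)) has_real_derivative f' z) (at 0)"
  shows "has_bochner_integral lborel f' 0"
proof -
  define q where "q n z = (f (z + (1 / real (Suc n)) *\<^sub>R v) - f z) * real (Suc n)" for n z
  have "compact (f' ` K)"
    using K f' by (intro compact_continuous_image) (auto intro: continuous_on_subset)
  then obtain M where M: "\<And>z. z \<in> K \<Longrightarrow> \<bar>f' z\<bar> \<le> M" and Mpos: "M > 0"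
    by (metis bounded_pos compact_imp_bounded imageI real_norm_def)
  have M': "\<bar>f' z\<bar> \<le> M" for z
    using M Mpos f'0[of z] by (cases "z \<in> K") auto
  obtain R where R: "\<And>z. z \<in> K \<Longrightarrow> norm z \<le> R"
    using K by (meson bounded_iff compact_imp_bounded)
  \<comment> \<open>A step of length at most 1 in direction \<open>v\<close> that ends in \<open>K\<close> starts in \<open>B\<close>.\<close>
  define B where "B = cball (0::'a) (R + norm v)"
  have der': "((\<lambda>t. f (z + t *\<^sub>R v)) has_real_derivative f' (z + s *\<^sub>R v)) (at s)" for z s
    using der[of "z + s *\<^sub>R v"] DERIV_shift[of "\<lambda>t. f (z + t *\<^sub>R v)" _ 0 s]
    by (simp add: algebra_simps)
  have incr: "\<bar>f (z + t *\<^sub>R v) - f z\<bar> \<le> M * t" if t: "t > 0" for z t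
  proof -
    obtain s where "0 < s" "s < t" "f (z + t *\<^sub>R v) - f (z + 0 *\<^sub>R v) = (t - 0) * f' (z + s *\<^sub>R v)"
      using MVT2[OF t, of "\<lambda>t. f (z + t *\<^sub>R v)" "\<lambda>s. f' (z + s *\<^sub>R v)"] der' by blast
    then show ?thesis
      using M'[of "z + s *\<^sub>R v"] t by (simp add: abs_mult mult.commute mult_left_mono)
  qed
  have int_f: "integrable lborel f"
  proof -
    have "(\<lambda>z. indicator K z *\<^sub>R f z) = f" using f0 by (auto simp: indicator_def fun_eq_iff)
    then show ?thesis
      using borel_integrable_compact[OF K continuous_on_subset[OF f]] by simp
  qed
  have int_shift: "has_bochner_integral lborel (\<lambda>z. f (z + a)) (integral\<^sup>L lborel f)" for a
  proof -
    have "has_bochner_integral (distr lborel borel ((+) a)) f (integral\<^sup>L lborel f)"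
      using int_f by (simp add: lborel_distr_plus has_bochner_integral_integrable)
    moreover have "f \<in> borel_measurable borel" using f by (rule borel_measurable_continuous_onI)
    ultimately have "has_bochner_integral lborel (\<lambda>z. f (a + z)) (integral\<^sup>L lborel f)"
      by (simp add: has_bochner_integral_iff integrable_distr_eq integral_distr)
    then show ?thesis by (simp add: add.commute)
  qed
  have q: "has_bochner_integral lborel (q n) 0" for n
  proof -
    have "has_bochner_integral lborel
        (\<lambda>z. (f (z + (1 / real (Suc n)) *\<^sub>R v) - f (z + 0)) * real (Suc n))
        ((integral\<^sup>L lborel f - integral\<^sup>L lborel f) * real (Suc n))"
      by (intro has_bochner_integral_mult_left has_bochner_integral_diff int_shift)
    then show ?thesis by (simp add: q_def[abs_def])
  qed
  have lim: "(\<lambda>n. q n z) \<longlonglongrightarrow> f' z" for z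
  proof -
    have "((\<lambda>t. (f (z + t *\<^sub>R v) - f z) / t) \<longlongrightarrow> f' z) (at 0)"
      using der[of z] by (simp add: DERIV_def)
    moreover have "filterlim (\<lambda>n. 1 / real (Suc n)) (at 0) sequentially"
      using LIMSEQ_inverse_real_of_nat by (intro filterlim_atI) (auto simp: inverse_eq_divide)
    ultimately have "(\<lambda>n. (f (z + (1 / real (Suc n)) *\<^sub>R v) - f z) / (1 / real (Suc n))) \<longlonglongrightarrow> f' z"
      by (rule filterlim_compose)
    then show ?thesis by (simp add: q_def)
  qed
  have bd: "norm (q n z) \<le> M * indicator B z" for n z
  proof (cases "z \<in> B")
    case True
    have "norm (q n z) = \<bar>f (z + (1 / real (Suc n)) *\<^sub>R v) - f z\<bar> * real (Suc n)"
      by (simp add: q_def abs_mult del: of_nat_Suc)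
    also have "\<dots> \<le> M * (1 / real (Suc n)) * real (Suc n)"
      by (intro mult_right_mono incr) auto
    finally show ?thesis using True by simp
  next
    case False
    have "z \<notin> K" using False R[of z] norm_ge_zero[of v] unfolding B_def mem_cball_0 by linarith
    moreover have "z + (1 / real (Suc n)) *\<^sub>R v \<notin> K"
    proof
      assume "z + (1 / real (Suc n)) *\<^sub>R v \<in> K"
      then have "norm (z + (1 / real (Suc n)) *\<^sub>R v) \<le> R" by (rule R)
      moreover have "norm z \<le> norm (z + (1 / real (Suc n)) *\<^sub>R v) + norm ((1 / real (Suc n)) *\<^sub>R v)"
        using norm_triangle_ineq4[of "z + (1 / real (Suc n)) *\<^sub>R v" "(1 / real (Suc n)) *\<^sub>R v"]
        by (simp del: of_nat_Suc)
      moreover have "norm ((1 / real (Suc n)) *\<^sub>R v) \<le> norm v"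
        using mult_right_mono[of "1 / real (Suc n)" 1 "norm v"] by simp
      ultimately have "norm z \<le> R + norm v" by linarith
      then show False using False by (simp add: B_def)
    qed
    ultimately show ?thesis using f0 False by (simp add: q_def)
  qed
  have dom: "integrable lborel (\<lambda>z. M * indicator B z)"
    unfolding B_def by (intro integrable_mult_right integrable_real_indicator)
      (use emeasure_bounded_finite in \<open>auto simp: less_top[symmetric] infinity_ennreal_def\<close>)
  have meas: "f' \<in> borel_measurable lborel" "\<And>n. q n \<in> borel_measurable lborel"
    using f' q by (auto intro: borel_measurable_continuous_onI elim: has_bochner_integral.cases)
  have "integrable lborel f'"
    by (rule integrable_dominated_convergence[of f' lborel q "\<lambda>z. M * indicator B z"])
      (use meas dom lim bd in auto)
  moreover have "(\<lambda>n. integral\<^sup>L lborel (q n)) \<longlonglongrightarrow> integral\<^sup>L lborel f'"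
    by (rule integral_dominated_convergence[of f' lborel q "\<lambda>z. M * indicator B z"])
      (use meas dom lim bd in auto)
  then have "integral\<^sup>L lborel f' = 0"
    using q by (simp add: has_bochner_integral_iff LIMSEQ_const_iff)
  ultimately show ?thesis by (simp add: has_bochner_integral_iff)
qed


section \<open>Green's formula for the imaginary part of a local primitive\<close>

text \<open>
  The integrand is the derivative along \<open>v\<close> of \<open>h \<partial>\<^sub>v\<eta> - \<eta> \<partial>\<^sub>vh\<close>: the two products of first
  derivatives cancel, \<open>\<partial>\<^sub>vh = Im (g v)\<close> by assumption, and \<open>g\<close> changes along \<open>v\<close> at the rate \<open>g' v\<close>.
  The functions \<open>D\<close> and \<open>DD\<close> stand for the first and second derivative of \<open>\<eta>\<close> along \<open>v\<close>.
\<close>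

lemma has_bochner_integral_Green_direction:
  fixes h \<eta> D DD :: "complex \<Rightarrow> real" and v :: complex
  assumes V: "open V" and K: "compact K" "K \<subseteq> V" and g: "g holomorphic_on V"
    and h: "\<And>z. z \<in> V \<Longrightarrow> (h has_derivative (\<lambda>w. Im (g z * w))) (at z)"
    and cont: "continuous_on UNIV \<eta>" "continuous_on UNIV D" "continuous_on UNIV DD"
    and off: "\<And>z. z \<notin> K \<Longrightarrow> \<eta> z = 0" "\<And>z. z \<notin> K \<Longrightarrow> D z = 0" "\<And>z. z \<notin> K \<Longrightarrow> DD z = 0"
    and der: "\<And>z. ((\<lambda>t. \<eta> (z + t *\<^sub>R v)) has_real_derivative D z) (at 0)"
      "\<And>z. ((\<lambda>t. D (z + t *\<^sub>R v)) has_real_derivative DD z) (at 0)"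
  shows "has_bochner_integral lborel
    (\<lambda>z. if z \<in> V then h z * DD z - Im (deriv g z * v\<^sup>2) * \<eta> z else 0) 0"
proof (rule has_bochner_integral_directional_derivative_0[OF K(1)])
  let ?u = "\<lambda>z. h z * D z - Im (g z * v) * \<eta> z"
  let ?u' = "\<lambda>z. h z * DD z - Im (deriv g z * v\<^sup>2) * \<eta> z"
  have ch: "continuous_on V h"
    using h by (meson continuous_at_imp_continuous_on has_derivative_continuous)
  have cg: "continuous_on V g" "continuous_on V (deriv g)"
    using g V by (auto intro!: holomorphic_on_imp_continuous_on holomorphic_deriv)
  have cV: "continuous_on V \<eta>" "continuous_on V D" "continuous_on V DD"
    using cont by (auto intro: continuous_on_subset)
  show "continuous_on UNIV (\<lambda>z. if z \<in> V then ?u z else 0)"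
    using off by (intro continuous_on_extend_zero[OF V K] continuous_intros ch cg cV) auto
  show "continuous_on UNIV (\<lambda>z. if z \<in> V then ?u' z else 0)"
    using off by (intro continuous_on_extend_zero[OF V K] continuous_intros ch cg cV) auto
  show "(if z \<in> V then ?u z else 0) = 0" "(if z \<in> V then ?u' z else 0) = 0" if "z \<notin> K" for z
    using off that by auto
  fix z
  let ?l = "\<lambda>t::real. z + t *\<^sub>R v"
  have near: "eventually (\<lambda>t. ?l t \<in> S) (nhds 0)" if "open S" "z \<in> S" for S
  proof -
    have "(?l \<longlongrightarrow> ?l 0) (nhds 0)"
      by (intro tendsto_intros filterlim_ident)
    then show ?thesis using topological_tendstoD[of ?l _ "nhds 0" S] that by simp
  qed
  show "((\<lambda>t. if ?l t \<in> V then ?u (?l t) else 0)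
      has_real_derivative (if z \<in> V then ?u' z else 0)) (at 0)"
  proof (cases "z \<in> V")
    case True
    have l: "(?l has_derivative (\<lambda>t. t *\<^sub>R v)) (at 0)"
      by (auto intro!: derivative_eq_intros)
    have dh: "((\<lambda>t. h (?l t)) has_real_derivative Im (g z * v)) (at 0)"
      by (rule has_derivative_imp_has_field_derivative
          [OF has_derivative_compose[OF l, of h "\<lambda>w. Im (g z * w)"]])
        (use h[OF True] in \<open>simp_all add: algebra_simps\<close>)
    have "(g has_derivative (*) (deriv g z)) (at z)"
      using holomorphic_derivI[OF g V True] by (simp add: has_field_derivative_def)
    then have "((\<lambda>t. g (?l t)) has_derivative (\<lambda>t. deriv g z * (t *\<^sub>R v))) (at 0)"
      using has_derivative_compose[OF l, of g "(*) (deriv g z)"] by simp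
    then have "((\<lambda>t. Im (g (?l t) * v)) has_derivative (\<lambda>t. Im (deriv g z * (t *\<^sub>R v) * v))) (at 0)"
      by (intro has_derivative_Im has_derivative_mult_left)
    then have dg: "((\<lambda>t. Im (g (?l t) * v)) has_real_derivative Im (deriv g z * v\<^sup>2)) (at 0)"
      by (rule has_derivative_imp_has_field_derivative)
        (simp add: power2_eq_square algebra_simps)
    have "((\<lambda>t. ?u (?l t)) has_real_derivative ?u' z) (at 0)"
      using DERIV_diff[OF DERIV_mult[OF dh der(2)[of z]] DERIV_mult[OF dg der(1)[of z]]]
      by (simp add: algebra_simps)
    moreover have "eventually (\<lambda>t. ?u (?l t) = (if ?l t \<in> V then ?u (?l t) else 0)) (nhds 0)"
      using near[OF V True] by eventually_elim simp
    ultimately show ?thesis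
      using True DERIV_cong_ev[of 0 0 "\<lambda>t. ?u (?l t)" _ "?u' z" "?u' z"] by simp
  next
    case False
    have "eventually (\<lambda>t. ?l t \<in> - K) (nhds 0)"
      using False K by (intro near) (auto simp: compact_imp_closed open_Compl)
    then have "eventually (\<lambda>t. (if ?l t \<in> V then ?u (?l t) else 0) = 0) (nhds 0)"
      by eventually_elim (simp add: off)
    then show ?thesis
      using False DERIV_cong_ev[of 0 0 _ "\<lambda>_. 0" 0 0] by simp
  qed
qed

lemma has_real_derivative_partial:
  assumes "\<eta> differentiable_on UNIV"
  shows "((\<lambda>t. \<eta> (z + t *\<^sub>R 1)) has_real_derivative partial_x \<eta> z) (at 0)"
    and "((\<lambda>t. \<eta> (z + t *\<^sub>R \<i>)) has_real_derivative partial_y \<eta> z) (at 0)"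
proof -
  have *: "((\<lambda>t. \<eta> (z + t *\<^sub>R v)) has_real_derivative deriv (\<lambda>t. \<eta> (z + t *\<^sub>R v)) 0) (at 0)" for v
  proof -
    obtain \<eta>' where "(\<eta> has_derivative \<eta>') (at (z + 0 *\<^sub>R v))"
      using assms by (auto simp: differentiable_on_def differentiable_def)
    moreover have "((\<lambda>t. z + t *\<^sub>R v) has_derivative (\<lambda>t. t *\<^sub>R v)) (at 0)"
      by (auto intro!: derivative_eq_intros)
    ultimately have "((\<lambda>t. \<eta> (z + t *\<^sub>R v)) has_derivative (\<lambda>t. \<eta>' (t *\<^sub>R v))) (at 0)"
      using has_derivative_compose[of "\<lambda>t. z + t *\<^sub>R v" "\<lambda>t. t *\<^sub>R v" 0 UNIV \<eta> \<eta>'] by (simp only:)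
    then have "(\<lambda>t. \<eta> (z + t *\<^sub>R v)) differentiable (at 0)"
      by (rule differentiableI)
    then show ?thesis
      by (simp only: DERIV_deriv_iff_real_differentiable)
  qed
  have "partial_x \<eta> z = deriv (\<lambda>t. \<eta> (z + t *\<^sub>R 1)) 0"
    by (simp only: partial_x_def of_real_def)
  then show "((\<lambda>t. \<eta> (z + t *\<^sub>R 1)) has_real_derivative partial_x \<eta> z) (at 0)"
    using *[of 1] by (simp only:)
  have "partial_y \<eta> z = deriv (\<lambda>t. \<eta> (z + t *\<^sub>R \<i>)) 0"
    by (simp only: partial_y_def of_real_def mult_scaleR_right mult_1_right)
  then show "((\<lambda>t. \<eta> (z + t *\<^sub>R \<i>)) has_real_derivative partial_y \<eta> z) (at 0)"
    using *[of \<i>] by (simp only:)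
qed

lemma partial_eq_0:
  assumes "open S" "z \<in> S" "\<And>w. w \<in> S \<Longrightarrow> f w = 0"
  shows "partial_x f z = 0" "partial_y f z = 0"
proof -
  have *: "((\<lambda>t. f (l t)) has_real_derivative 0) (at 0)"
    if l: "continuous (at 0) l" "l 0 = z" for l :: "real \<Rightarrow> complex"
  proof -
    have "(l \<longlongrightarrow> z) (nhds 0)"
      using l tendsto_at_iff_tendsto_nhds[of l 0] by (simp add: continuous_at)
    then have "eventually (\<lambda>t. l t \<in> S) (nhds 0)"
      using assms(1,2) by (rule topological_tendstoD)
    then have "eventually (\<lambda>t. f (l t) = 0) (nhds 0)"
      by eventually_elim (rule assms(3))
    then show ?thesis
      by (rule DERIV_cong_ev[THEN iffD2, OF refl _ refl DERIV_const])
  qed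
  show "partial_x f z = 0" "partial_y f z = 0"
    unfolding partial_x_def partial_y_def
    by (intro DERIV_imp_deriv * continuous_intros; simp)+
qed

text \<open>
  The weak form of harmonicity. The domain \<open>S\<close> of integration may exceed \<open>V\<close>, since the integrand
  vanishes outside the support of \<open>\<eta>\<close>; this matters because the Levy form integrates over a whole
  chart, in parts of which \<open>h\<close> is arbitrary.
\<close>

lemma integral_laplacian_test_function_0:
  assumes V: "open V" "V \<subseteq> S" and g: "g holomorphic_on V"
    and h: "\<And>z. z \<in> V \<Longrightarrow> (h has_derivative (\<lambda>w. Im (g z * w))) (at z)"
    and \<eta>: "test_function_on V \<eta>"
  shows "(LINT z:S|lborel. h z * laplacian \<eta> z) = 0"
proof -
  define K where "K = closure {z. \<eta> z \<noteq> 0}"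
  have K: "compact K" "K \<subseteq> V" using \<eta> by (auto simp: test_function_on_def K_def)
  have oK: "open (- K)" by (simp add: K_def open_Compl)
  have "Ck_on 2 UNIV \<eta>" using \<eta> by (simp add: test_function_on_def smooth_on_def)
  then have d: "\<eta> differentiable_on UNIV" "partial_x \<eta> differentiable_on UNIV"
      "partial_y \<eta> differentiable_on UNIV"
    and c: "continuous_on UNIV (partial_x (partial_x \<eta>))"
      "continuous_on UNIV (partial_y (partial_y \<eta>))"
    by (simp_all add: numeral_2_eq_2)
  note d' = d[THEN differentiable_imp_continuous_on]
  have off: "\<eta> z = 0" if "z \<in> - K" for z
    using that closure_subset[of "{z. \<eta> z \<noteq> 0}"] by (auto simp: K_def)
  have off1: "partial_x \<eta> z = 0" "partial_y \<eta> z = 0" if "z \<in> - K" for z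
    using partial_eq_0[OF oK that] off by auto
  have off2: "partial_x (partial_x \<eta>) z = 0" "partial_y (partial_y \<eta>) z = 0" if "z \<in> - K" for z
    using partial_eq_0[OF oK that] off1 by auto
  let ?ux = "\<lambda>z. if z \<in> V then h z * partial_x (partial_x \<eta>) z - Im (deriv g z * 1\<^sup>2) * \<eta> z else 0"
  let ?uy = "\<lambda>z. if z \<in> V then h z * partial_y (partial_y \<eta>) z - Im (deriv g z * \<i>\<^sup>2) * \<eta> z else 0"
  have "has_bochner_integral lborel ?ux 0"
    by (rule has_bochner_integral_Green_direction[OF V(1) K g h, where D = "partial_x \<eta>"])
      (use d d' c off off1 off2 has_real_derivative_partial(1) in auto)
  moreover have "has_bochner_integral lborel ?uy 0"
    by (rule has_bochner_integral_Green_direction[OF V(1) K g h, where D = "partial_y \<eta>"])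
      (use d d' c off off1 off2 has_real_derivative_partial(2) in auto)
  ultimately have "has_bochner_integral lborel (\<lambda>z. ?ux z + ?uy z) (0 + 0)"
    by (rule has_bochner_integral_add)
  moreover have "?ux z + ?uy z = indicator S z *\<^sub>R (h z * laplacian \<eta> z)" for z
  proof (cases "z \<in> V")
    case True
    then show ?thesis using V(2) by (auto simp: laplacian_def algebra_simps)
  next
    case False
    then have "z \<in> - K" using K(2) by auto
    then show ?thesis using False off2[of z] by (simp add: laplacian_def)
  qed
  ultimately show ?thesis
    by (simp add: set_lebesgue_integral_def has_bochner_integral_iff)
qed


section \<open>The critical set is closed\<close>

lemma open_chart_image:
  assumes "is_chart c" "open W"
  shows "open (snd c ` (fst c \<inter> W))"
proof -
  have hom: "homeomorphism (fst c) (snd c ` fst c) (snd c) (chart_inv c)"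
    and o: "open (fst c)" "open (snd c ` fst c)"
    using assms(1) by (auto simp: is_chart_def)
  have "openin (top_of_set (snd c ` fst c)) (snd c ` (fst c \<inter> W))"
    using homeomorphism_imp_open_map[OF hom] assms(2) by (simp add: openin_open_Int)
  then show ?thesis using o(2) openin_open_trans by blast
qed

text \<open>
  At a pole the coefficient has the conventional value 0, so both zeros and poles are recorded by the
  value of the coefficient. The transformation rule carries the value 0 from any chart to \<open>c\<close>.
\<close>

lemma critical_point_iff:
  assumes "meromorphic_qdiff A \<Psi>" "c \<in> A" "p \<in> fst c" "inj_on (snd c) (fst c)"
  shows "p \<in> critical_points A \<Psi> \<longleftrightarrow> \<Psi> c (snd c p) = 0"
proof
  assume "\<Psi> c (snd c p) = 0"
  then show "p \<in> critical_points A \<Psi>"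
    using assms by (auto simp: critical_points_def qdiff_zeros_def qdiff_poles_def)
next
  assume "p \<in> critical_points A \<Psi>"
  then obtain d where d: "d \<in> A" "p \<in> fst d" "\<Psi> d (snd d p) = 0 \<or> is_pole (\<Psi> d) (snd d p)"
    by (auto simp: critical_points_def qdiff_zeros_def qdiff_poles_def)
  have "\<Psi> d nicely_meromorphic_on snd d ` fst d"
    using assms(1) d(1) by (auto simp: meromorphic_qdiff_def)
  then have "\<Psi> d (snd d p) = 0"
    using d(2,3) is_pole_zero_at_nicely_mero by blast
  moreover have "transition c d (snd c p) = snd d p"
    using assms by (simp add: transition_def)
  moreover have "\<Psi> c (snd c p) = \<Psi> d (transition c d (snd c p)) * (deriv (transition c d) (snd c p))\<^sup>2"
    using assms(1-3) d(1,2) unfolding meromorphic_qdiff_def by blast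
  ultimately show "\<Psi> c (snd c p) = 0"
    by simp
qed

text \<open>
  A nonzero value of the coefficient excludes a pole, so the coefficient is analytic there and stays
  nonzero nearby.
\<close>

lemma closed_critical_points:
  assumes A: "holomorphic_atlas A" and \<Psi>: "meromorphic_qdiff A \<Psi>"
  shows "closed (critical_points A \<Psi>)"
  unfolding closed_def
proof (subst open_subopen, intro ballI)
  fix p assume p: "p \<in> - critical_points A \<Psi>"
  obtain c where c: "c \<in> A" "p \<in> fst c"
    using A by (metis UN_E UNIV_I holomorphic_atlas_def)
  have ch: "is_chart c" using A c by (auto simp: holomorphic_atlas_def)
  then have inj: "inj_on (snd c) (fst c)" and o: "open (fst c)" "continuous_on (fst c) (snd c)"
    unfolding is_chart_def by (auto simp: homeomorphism_def intro: inj_on_inverseI)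
  note crit = critical_point_iff[OF \<Psi> c(1) _ inj]
  have nz: "\<Psi> c (snd c p) \<noteq> 0" using p crit[OF c(2)] by simp
  have nm: "\<Psi> c nicely_meromorphic_on snd c ` fst c"
    using \<Psi> c(1) by (auto simp: meromorphic_qdiff_def)
  then have "\<Psi> c analytic_on {snd c p}"
    using nz c(2) by (meson analytic_at_imp_isCont is_pole_zero_at_nicely_mero
        nicely_meromorphic_on_imp_analytic_at imageI)
  then have "isCont (\<Psi> c) (snd c p)" by (rule analytic_at_imp_isCont)
  then have "eventually (\<lambda>z. \<Psi> c z \<noteq> 0) (nhds (snd c p))"
    using nz by (intro tendsto_imp_eventually_ne) (auto simp: isCont_def tendsto_at_iff_tendsto_nhds)
  then obtain S where S: "open S" "snd c p \<in> S" "\<And>z. z \<in> S \<Longrightarrow> \<Psi> c z \<noteq> 0"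
    by (auto simp: eventually_nhds)
  have "open (fst c \<inter> snd c -` S)" using o S(1) by (simp add: continuous_on_open_vimage Int_commute)
  then show "\<exists>T. open T \<and> p \<in> T \<and> T \<subseteq> - critical_points A \<Psi>"
    using S c crit by (intro exI[of _ "fst c \<inter> snd c -` S"]) auto
qed

corollary closed_critical_set:
  assumes "holomorphic_atlas A" "meromorphic_qdiff A \<Psi>"
  shows "closed (critical_graph A \<Psi> \<union> critical_points A \<Psi>)"
  using closed_critical_points[OF assms] by (auto simp: critical_graph_def)


section \<open>Potentials are harmonic off the critical set\<close>

text \<open>
  The branches and signs belonging to the different components are combined into one function \<open>g\<close> on
  the coordinate image of their union. It is holomorphic because each small disc is mapped into
  a single component, on which branch and sign are fixed.
\<close>

lemma natural_level_function_local_derivative: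
  assumes A: "holomorphic_atlas A" and \<Psi>: "meromorphic_qdiff A \<Psi>"
    and F: "natural_level_function A \<Psi> F" and c: "c \<in> A"
  defines "V \<equiv> snd c ` (fst c \<inter> - (critical_graph A \<Psi> \<union> critical_points A \<Psi>))"
  obtains g where "g holomorphic_on V"
    and "\<And>z. z \<in> V \<Longrightarrow> (F \<circ> chart_inv c has_derivative (\<lambda>w. Im (g z * w))) (at z)"
proof -
  define W where "W = - (critical_graph A \<Psi> \<union> critical_points A \<Psi>)"
  define \<phi> where "\<phi> = chart_inv c"
  have ch: "is_chart c" using A c by (auto simp: holomorphic_atlas_def)
  then have cont: "continuous_on (snd c ` fst c) \<phi>" and inv: "\<And>p. p \<in> fst c \<Longrightarrow> \<phi> (snd c p) = p"
    by (auto simp: is_chart_def homeomorphism_def \<phi>_def)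
  have VW: "V = snd c ` (fst c \<inter> W)" by (simp add: V_def W_def)
  have "open W" unfolding W_def
    using closed_critical_set[OF A \<Psi>] by (rule open_Compl)
  then have V: "open V" unfolding VW by (rule open_chart_image[OF ch])
  \<comment> \<open>One predicate for branch and sign together, because both are chosen at once for every component.\<close>
  define br where "br C \<omega> \<epsilon> \<longleftrightarrow> sqrt_branch A \<Psi> C \<omega> \<and> (\<forall>z\<in>snd c ` (fst c \<inter> C).
      (F \<circ> \<phi> has_derivative (\<lambda>v. \<epsilon> * Im (\<omega> c z * v))) (at z))" for C \<omega> \<epsilon>
  have "\<exists>\<omega> \<epsilon>. br C \<omega> \<epsilon>" if C: "C \<in> components W" for C
  proof -
    obtain \<omega> \<epsilon> where "sqrt_branch A \<Psi> C \<omega>" and "\<forall>c\<in>A. \<forall>z\<in>snd c ` (fst c \<inter> C).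
        (F \<circ> chart_inv c has_derivative (\<lambda>v. \<epsilon> * Im (\<omega> c z * v))) (at z)"
      using F C unfolding natural_level_function_def W_def by meson
    then show ?thesis using c unfolding br_def \<phi>_def by meson
  qed
  then obtain \<omega> \<epsilon> where br: "\<And>C. C \<in> components W \<Longrightarrow> br C (\<omega> C) (\<epsilon> C)"
    by metis
  define C where "C z = connected_component_set W (\<phi> z)" for z
  define g where "g z = of_real (\<epsilon> (C z)) * \<omega> (C z) c z" for z
  have \<phi>V: "\<phi> z \<in> W" "\<phi> z \<in> fst c" "snd c (\<phi> z) = z" if "z \<in> V" for z
    using that inv by (auto simp: VW)
  have C: "C z \<in> components W" "z \<in> snd c ` (fst c \<inter> C z)" if "z \<in> V" for z
    using \<phi>V[OF that] by (auto simp: C_def components_def image_iff intro!: bexI[of _ "\<phi> z"])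
  have "g field_differentiable (at z)" if z: "z \<in> V" for z
  proof -
    obtain r where r: "r > 0" "ball z r \<subseteq> V" using V z open_contains_ball by blast
    have "connected (\<phi> ` ball z r)"
      using r(2) by (intro connected_continuous_image continuous_on_subset[OF cont]) (auto simp: VW)
    moreover have "\<phi> ` ball z r \<subseteq> W" "\<phi> z \<in> \<phi> ` ball z r" using r \<phi>V by auto
    ultimately have "\<phi> ` ball z r \<subseteq> C z" unfolding C_def by (intro connected_component_maximal)
    then have Ceq: "C w = C z" if "w \<in> ball z r" for w
      using that connected_component_eq unfolding C_def by blast
    have "ball z r \<subseteq> snd c ` (fst c \<inter> C z)"
      using C(2) Ceq r(2) by blast
    then have "\<omega> (C z) c holomorphic_on ball z r"
      using br[OF C(1)[OF z]] c unfolding br_def sqrt_branch_def by (meson holomorphic_on_subset)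
    then have "(\<lambda>w. of_real (\<epsilon> (C z)) * \<omega> (C z) c w) holomorphic_on ball z r"
      by (intro holomorphic_intros)
    then have "g holomorphic_on ball z r"
      by (rule holomorphic_transform) (simp only: g_def Ceq)
    then show ?thesis using r(1) holomorphic_on_imp_differentiable_at by (metis centre_in_ball open_ball)
  qed
  then have "g holomorphic_on V"
    unfolding holomorphic_on_def by (auto intro: field_differentiable_at_within)
  moreover have "(F \<circ> \<phi> has_derivative (\<lambda>w. Im (g z * w))) (at z)" if "z \<in> V" for z
  proof -
    have "(F \<circ> \<phi> has_derivative (\<lambda>w. \<epsilon> (C z) * Im (\<omega> (C z) c z * w))) (at z)"
      using br[OF C(1)[OF that]] C(2)[OF that] unfolding br_def by blast
    then show ?thesis by (simp add: g_def mult.assoc)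
  qed
  ultimately show ?thesis using that by (simp add: \<phi>_def)
qed

theorem lemma5:
  fixes A :: "'a::t2_space chart set" and \<Psi> :: "'a qdiff" and F :: "'a \<Rightarrow> real"
  assumes "compact_riemann_surface A"
    and "meromorphic_qdiff A \<Psi>"
    and "not_identically_zero A \<Psi>"
    and "gradient_qdiff A \<Psi>"
    and "potential A \<Psi> F"
  shows "current_supported_on A (levy_form F) (critical_graph A \<Psi> \<union> critical_points A \<Psi>)"
  unfolding current_supported_on_def current_vanishes_on_def
proof (intro ballI allI impI)
  fix c \<eta>
  let ?W = "- (critical_graph A \<Psi> \<union> critical_points A \<Psi>)"
  assume c: "c \<in> A" and \<eta>: "test_function_on (snd c ` (fst c \<inter> ?W)) \<eta>"
  have A: "holomorphic_atlas A" using assms(1) by (simp add: compact_riemann_surface_def)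
  have F: "natural_level_function A \<Psi> F" using assms(5) by (simp add: potential_def)
  have "open ?W"
    using closed_critical_set[OF A assms(2)] by (rule open_Compl)
  then have V: "open (snd c ` (fst c \<inter> ?W))"
    using A c by (intro open_chart_image) (auto simp: holomorphic_atlas_def)
  obtain g where "g holomorphic_on snd c ` (fst c \<inter> ?W)"
    and "\<And>z. z \<in> snd c ` (fst c \<inter> ?W) \<Longrightarrow>
      (F \<circ> chart_inv c has_derivative (\<lambda>w. Im (g z * w))) (at z)"
    using natural_level_function_local_derivative[OF A assms(2) F c] by metis
  from integral_laplacian_test_function_0[OF V _ this \<eta>, of "snd c ` fst c"]
  show "levy_form F c \<eta> = 0"
    by (simp add: levy_form_def image_mono)
qed

end
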